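(* Let $n\ge 4$. The $\widetilde C_{n-2}$-action on the set of arc permutations $\mathcal{A}_n$ in which the generator $s_i$ acts by $\rho_i$ ($0\le i\le n-2$) is transitive.
   Context: An interval in $\mathbb{Z}_n$ is a subset of $\{1,\dots,n\}$ of the form $[a,b]$ or $[b,n]\cup[1,a]$ with $1\le a\le b\le n$. $\mathcal{A}_n$ is the set of arc permutations: those $\pi\in\mathcal{S}_n$ such that for every $1\le j\le n$ the set $\{\pi(1),\dots,\pi(j)\}$ is an interval in $\mathbb{Z}_n$. Let $\sigma_i=(i,i+1)$, with $\pi\sigma_i$ obtained from $\pi$ by exchanging the letters in positions $i$ and $i+1$. For $0\le i\le n-2$, $\rho_i(\pi)=\pi\sigma_{i+1}$ if $\pi\sigma_{i+1}\in\mathcal{A}_n$, and $\rho_i(\pi)=\pi$ otherwise. The affine Weyl group $\widetilde C_{n-2}$ is generated by $s_0,s_1,\dots,s_{n-2}$ subject to the relations: $s_i^2=1$ for all $i$; $(s_is_j)^2=1$ for $|j-i|>1$; $(s_is_{i+1})^3=1$ for $1\le i<n-3$; $(s_is_{i+1})^4=1$ for $i=0$ and $i=n-3$. The assignment $s_i\mapsto\rho_i$ determines a well-defined action of $\widetilde C_{n-2}$ on $\mathcal{A}_n$. *)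

theory Defs
  imports "HOL-Algebra.Group_Action" "HOL-Combinatorics.Permutations"
begin

section \<open>Groups given by generators and relators\<close>

text \<open>
  A word is a list of signed letters; \<open>(x, True)\<close> stands for the generator \<open>x\<close> and
  \<open>(x, False)\<close> for its formal inverse.
\<close>

type_synonym 'a word = "('a \<times> bool) list"

definition words :: "'a set \<Rightarrow> 'a word set" where
  "words S = lists (S \<times> UNIV)"

text \<open>
  \<open>pres_eq S R\<close> is the least congruence on the words over \<open>S\<close> that contains free cancellation
  and makes every relator in \<open>R\<close> trivial.
\<close>

inductive pres_eq :: "'a set \<Rightarrow> 'a word set \<Rightarrow> 'a word \<Rightarrow> 'a word \<Rightarrow> bool"
  for S :: "'a set" and R :: "'a word set" where
  refl: "w \<in> words S \<Longrightarrow> pres_eq S R w w"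
| sym: "pres_eq S R v w \<Longrightarrow> pres_eq S R w v"
| trans: "pres_eq S R u v \<Longrightarrow> pres_eq S R v w \<Longrightarrow> pres_eq S R u w"
| cancel: "u \<in> words S \<Longrightarrow> v \<in> words S \<Longrightarrow> x \<in> S
    \<Longrightarrow> pres_eq S R (u @ [(x, b), (x, \<not> b)] @ v) (u @ v)"
| relator: "u \<in> words S \<Longrightarrow> v \<in> words S \<Longrightarrow> r \<in> R \<Longrightarrow> r \<in> words S
    \<Longrightarrow> pres_eq S R (u @ r @ v) (u @ v)"

definition pres_class :: "'a set \<Rightarrow> 'a word set \<Rightarrow> 'a word \<Rightarrow> 'a word set" where
  "pres_class S R w = {v. pres_eq S R w v}"

definition presented_group :: "'a set \<Rightarrow> 'a word set \<Rightarrow> 'a word set monoid" where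
  "presented_group S R =
    \<lparr>carrier = pres_class S R ` words S,
     monoid.mult = (\<lambda>X Y. \<Union>u\<in>X. \<Union>v\<in>Y. pres_class S R (u @ v)),
     one = pres_class S R []\<rparr>"

lemma words_simps [simp]:
  "[] \<in> words S"
  "p # w \<in> words S \<longleftrightarrow> fst p \<in> S \<and> w \<in> words S"
  "u @ v \<in> words S \<longleftrightarrow> u \<in> words S \<and> v \<in> words S"
  by (cases p; auto simp: words_def)+

lemma pres_eq_words:
  "pres_eq S R v w \<Longrightarrow> v \<in> words S \<and> w \<in> words S"
  by (induction rule: pres_eq.induct) auto

lemma pres_eq_append_left:
  "pres_eq S R v w \<Longrightarrow> u \<in> words S \<Longrightarrow> pres_eq S R (u @ v) (u @ w)"
proof (induction rule: pres_eq.induct)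
  case (refl w) then show ?case by (auto intro: pres_eq.refl)
next
  case (sym v w) then show ?case by (blast intro: pres_eq.sym)
next
  case (trans v w x) then show ?case by (blast intro: pres_eq.trans)
next
  case (cancel p q x b)
  then show ?case using pres_eq.cancel[of "u @ p" S q x R b] by simp
next
  case (relator p q r)
  then show ?case using pres_eq.relator[of "u @ p" S q r R] by simp
qed

lemma pres_eq_append_right:
  "pres_eq S R v w \<Longrightarrow> u \<in> words S \<Longrightarrow> pres_eq S R (v @ u) (w @ u)"
proof (induction rule: pres_eq.induct)
  case (refl w) then show ?case by (auto intro: pres_eq.refl)
next
  case (sym v w) then show ?case by (blast intro: pres_eq.sym)
next
  case (trans v w x) then show ?case by (blast intro: pres_eq.trans)
next
  case (cancel p q x b)
  then show ?case using pres_eq.cancel[of p S "q @ u" x R b] by simp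
next
  case (relator p q r)
  then show ?case using pres_eq.relator[of p S "q @ u" r R] by simp
qed

lemma pres_class_eq_iff:
  assumes "v \<in> words S"
  shows "pres_class S R v = pres_class S R w \<longleftrightarrow> pres_eq S R v w"
proof
  assume "pres_class S R v = pres_class S R w"
  then have "v \<in> pres_class S R w"
    using assms pres_eq.refl by (auto simp: pres_class_def)
  then show "pres_eq S R v w" by (auto simp: pres_class_def intro: pres_eq.sym)
next
  assume "pres_eq S R v w"
  then show "pres_class S R v = pres_class S R w"
    unfolding pres_class_def by (blast intro: pres_eq.sym pres_eq.trans)
qed

lemma presented_group_mult:
  assumes "u \<in> words S" "v \<in> words S"
  shows "pres_class S R u \<otimes>\<^bsub>presented_group S R\<^esub> pres_class S R v = pres_class S R (u @ v)"
proof -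
  have "pres_class S R (u' @ v') = pres_class S R (u @ v)"
    if "u' \<in> pres_class S R u" "v' \<in> pres_class S R v" for u' v'
  proof -
    from that have e: "pres_eq S R u u'" "pres_eq S R v v'" by (auto simp: pres_class_def)
    have "pres_eq S R (u @ v) (u' @ v')"
      using pres_eq_append_right[OF e(1) assms(2)] pres_eq_append_left[OF e(2)]
        pres_eq_words[OF e(1)] pres_eq.trans by blast
    then show ?thesis using assms pres_class_eq_iff[of "u @ v" S R "u' @ v'"] by simp
  qed
  moreover have "u \<in> pres_class S R u" "v \<in> pres_class S R v"
    using assms pres_eq.refl by (auto simp: pres_class_def)
  ultimately have "(\<Union>u'\<in>pres_class S R u. \<Union>v'\<in>pres_class S R v. pres_class S R (u' @ v'))
      = pres_class S R (u @ v)"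
    by (intro equalityI subsetI; blast)
  then show ?thesis by (simp add: presented_group_def)
qed

definition word_inv :: "'a word \<Rightarrow> 'a word" where
  "word_inv w = rev (map (\<lambda>(x, b). (x, \<not> b)) w)"

lemma word_inv_words: "w \<in> words S \<Longrightarrow> word_inv w \<in> words S"
  by (auto simp: word_inv_def words_def)

lemma word_inv_cancel: "w \<in> words S \<Longrightarrow> pres_eq S R (word_inv w @ w) []"
proof (induction w)
  case Nil then show ?case by (auto simp: word_inv_def intro: pres_eq.refl)
next
  case (Cons p w)
  obtain x b where p: "p = (x, b)" by (cases p)
  have "pres_eq S R (word_inv w @ [(x, \<not> b), (x, \<not> \<not> b)] @ w) (word_inv w @ w)"
    using Cons.prems p by (intro pres_eq.cancel word_inv_words) auto
  moreover have "word_inv (p # w) @ p # w = word_inv w @ [(x, \<not> b), (x, \<not> \<not> b)] @ w"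
    by (simp add: word_inv_def p)
  moreover have "pres_eq S R (word_inv w @ w) []"
    using Cons by simp
  ultimately show ?case by (metis pres_eq.trans)
qed

lemma group_presented_group: "group (presented_group S R)"
proof (rule groupI)
  let ?G = "presented_group S R"
  have carr: "carrier ?G = pres_class S R ` words S"
    and one: "\<one>\<^bsub>?G\<^esub> = pres_class S R []"
    by (simp_all add: presented_group_def)
  show "\<one>\<^bsub>?G\<^esub> \<in> carrier ?G" by (auto simp: carr one)
  show "X \<otimes>\<^bsub>?G\<^esub> Y \<in> carrier ?G" if "X \<in> carrier ?G" "Y \<in> carrier ?G" for X Y
    using that by (auto simp: carr presented_group_mult)
  show "X \<otimes>\<^bsub>?G\<^esub> Y \<otimes>\<^bsub>?G\<^esub> Z = X \<otimes>\<^bsub>?G\<^esub> (Y \<otimes>\<^bsub>?G\<^esub> Z)"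
    if "X \<in> carrier ?G" "Y \<in> carrier ?G" "Z \<in> carrier ?G" for X Y Z
    using that by (auto simp: carr presented_group_mult)
  show "\<one>\<^bsub>?G\<^esub> \<otimes>\<^bsub>?G\<^esub> X = X" if "X \<in> carrier ?G" for X
    using that by (auto simp: carr one presented_group_mult)
  show "\<exists>Y\<in>carrier ?G. Y \<otimes>\<^bsub>?G\<^esub> X = \<one>\<^bsub>?G\<^esub>" if X: "X \<in> carrier ?G" for X
  proof -
    from X obtain w where w: "w \<in> words S" "X = pres_class S R w" by (auto simp: carr)
    have "pres_class S R (word_inv w @ w) = pres_class S R []"
      using w word_inv_words[OF w(1)] word_inv_cancel[OF w(1)]
      by (subst pres_class_eq_iff) auto
    then show ?thesis
      using w word_inv_words[OF w(1)] by (auto simp: carr one presented_group_mult)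
  qed
qed

lemma presented_group_relator:
  assumes "r \<in> R" "r \<in> words S"
  shows "pres_class S R r = \<one>\<^bsub>presented_group S R\<^esub>"
  using assms pres_eq.relator[of "[]" S "[]" r R]
  by (simp add: presented_group_def pres_class_eq_iff)


section \<open>The affine Weyl group of type C\<close>

definition word_pow :: "'a word \<Rightarrow> nat \<Rightarrow> 'a word" where
  "word_pow w k = concat (replicate k w)"

text \<open>
  The parameter \<open>m\<close> is the rank; the generators are \<open>s\<^sub>0, \<dots>, s\<^sub>m\<close>, written as the letters
  \<open>0, \<dots>, m\<close>. The presentation is the intended one for \<open>m \<ge> 2\<close>.
\<close>

definition affine_C_relators :: "nat \<Rightarrow> nat word set" where
  "affine_C_relators m =
     {word_pow [(i, True)] 2 | i. i \<le> m}
   \<union> {word_pow [(i, True), (j, True)] 2 | i j. i \<le> m \<and> j \<le> m \<and> \<bar>int j - int i\<bar> > 1}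
   \<union> {word_pow [(i, True), (i + 1, True)] 3 | i. 1 \<le> i \<and> i < m - 1}
   \<union> {word_pow [(i, True), (i + 1, True)] 4 | i. i = 0 \<or> i = m - 1}"

definition affine_C :: "nat \<Rightarrow> nat word set monoid" where
  "affine_C m = presented_group {0..m} (affine_C_relators m)"

definition affine_C_gen :: "nat \<Rightarrow> nat \<Rightarrow> nat word set" where
  "affine_C_gen m i = pres_class {0..m} (affine_C_relators m) [(i, True)]"


section \<open>Arc permutations\<close>

definition cyclic_interval :: "nat \<Rightarrow> nat set \<Rightarrow> bool" where
  "cyclic_interval n I \<longleftrightarrow>
    (\<exists>a b. 1 \<le> a \<and> a \<le> b \<and> b \<le> n \<and> (I = {a..b} \<or> I = {b..n} \<union> {1..a}))"

definition arc_permutations :: "nat \<Rightarrow> (nat \<Rightarrow> nat) set" where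
  "arc_permutations n =
    {\<pi>. \<pi> permutes {1..n} \<and> (\<forall>j. 1 \<le> j \<and> j \<le> n \<longrightarrow> cyclic_interval n (\<pi> ` {1..j}))}"

definition arc_rho :: "nat \<Rightarrow> nat \<Rightarrow> (nat \<Rightarrow> nat) \<Rightarrow> (nat \<Rightarrow> nat)" where
  "arc_rho n i \<pi> =
    (if \<pi> \<circ> transpose (i + 1) (i + 2) \<in> arc_permutations n
     then \<pi> \<circ> transpose (i + 1) (i + 2) else \<pi>)"

text \<open>
  Since the classes of the letters generate the group, these conditions determine \<open>\<phi>\<close> on its
  carrier; outside the carrier \<open>\<phi>\<close> is unconstrained.
\<close>

definition arc_action :: "nat \<Rightarrow> (nat word set \<Rightarrow> (nat \<Rightarrow> nat) \<Rightarrow> (nat \<Rightarrow> nat)) \<Rightarrow> bool" where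
  "arc_action n \<phi> \<longleftrightarrow>
     group_action (affine_C (n - 2)) (arc_permutations n) \<phi>
   \<and> (\<forall>i \<le> n - 2. \<forall>\<pi> \<in> arc_permutations n. \<phi> (affine_C_gen (n - 2) i) \<pi> = arc_rho n i \<pi>)"

end

(*
  The prefixes of an arc permutation are arcs {a_j, ..., a_j + j - 1} modulo n, and the left ends
  a_j can be lifted to integers so that each step either keeps a_j or lowers it by 1.  On such
  integer paths s_0, ..., s_{n-2} act by affine reflections, which are defined on all of Z^{n-1} and
  satisfy the Coxeter relations by linear algebra.  The lift determines the permutation
  and the reflections cover the maps rho_i, so the relations descend to arc permutations.
  For transitivity, some reflection lowers a given path by 1 at a single place unless the path is
  constantly equal to a prescribed lower bound c; so any two paths, with c a common lower bound,
  are brought to the same constant path.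
*)

theory Submission
  imports Defs
begin

section \<open>Arcs in the cyclic group\<close>

text \<open>The shift by 1 puts the values into the letters 1, ..., n, so the letter a corresponds
  to the integer a - 1 modulo n.\<close>

definition residue :: "nat \<Rightarrow> int \<Rightarrow> nat" where
  "residue n x = nat (x mod int n) + 1"

text \<open>Encoding by left end and length treats arcs that wrap past \<open>n\<close> like all
  others; the left end matters only modulo \<open>n\<close>, which leaves room for lifting.\<close>

definition arc :: "nat \<Rightarrow> int \<Rightarrow> nat \<Rightarrow> nat set" where
  "arc n a k = residue n ` {a..<a + int k}"

lemma residue_eq_iff: "n > 0 \<Longrightarrow> residue n x = residue n y \<longleftrightarrow> x mod int n = y mod int n"
  by (auto simp: residue_def nat_eq_iff2)

lemma residue_inj_on: "k \<le> n \<Longrightarrow> inj_on (residue n) {a..<a + int k}"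
proof (rule inj_onI)
  fix x y assume k: "k \<le> n" and x: "x \<in> {a..<a + int k}" and y: "y \<in> {a..<a + int k}"
    and e: "residue n x = residue n y"
  have n: "n > 0" using k x by auto
  have "int n dvd x - y" using e n by (simp add: residue_eq_iff mod_eq_dvd_iff)
  moreover have "\<bar>x - y\<bar> < int n" using x y k by auto
  ultimately show "x = y" using dvd_imp_le_int[of "x - y" "int n"] by auto
qed

lemma residue_add_period: "residue n (x + int n * t) = residue n x"
  by (simp add: residue_def)

lemma arc_add_period: "arc n (a + int n * t) k = arc n a k"
proof -
  have "{a + int n * t..<a + int n * t + int k} = (\<lambda>x. x + int n * t) ` {a..<a + int k}"
    by (simp add: add_ac)
  then show ?thesis
    unfolding arc_def by (simp only: image_image residue_add_period)
qed

lemma card_arc: "k \<le> n \<Longrightarrow> card (arc n a k) = k"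
  by (simp add: arc_def card_image residue_inj_on)

lemma arc_subset: "n > 0 \<Longrightarrow> arc n a k \<subseteq> {1..n}"
  using pos_mod_bound[of "int n"] by (auto simp: arc_def residue_def Suc_le_eq nat_less_iff)

lemma arc_full: "n > 0 \<Longrightarrow> arc n a n = {1..n}"
  by (intro card_subset_eq arc_subset) (auto simp: card_arc)

section \<open>Arcs and cyclic intervals\<close>

lemma arc_eq_interval:
  assumes "1 \<le> a" "a + k \<le> n + 1"
  shows "arc n (int a - 1) k = {a..<a + k}"
proof -
  have "residue n x = nat (x + 1)" if "x \<in> {int a - 1..<int a - 1 + int k}" for x
    using that assms by (simp add: residue_def mod_pos_pos_trivial nat_add_distrib)
  then have "arc n (int a - 1) k = (\<lambda>x. nat (x + 1)) ` {int a - 1..<int a - 1 + int k}"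
    unfolding arc_def by (intro image_cong) auto
  also have "\<dots> = {a..<a + k}"
  proof (intro equalityI subsetI)
    fix y assume "y \<in> {a..<a + k}"
    then show "y \<in> (\<lambda>x. nat (x + 1)) ` {int a - 1..<int a - 1 + int k}"
      by (intro image_eqI[of _ _ "int y - 1"]) auto
  qed auto
  finally show ?thesis .
qed

lemma arc_split: "arc n a (j + k) = arc n a j \<union> arc n (a + int j) k"
proof -
  have "{a..<a + int (j + k)} = {a..<a + int j} \<union> {a + int j..<a + int j + int k}" by auto
  then show ?thesis unfolding arc_def by (simp only: image_Un)
qed

text \<open>With the left end normalised to a letter \<open>b\<close>, the arc either stops by
  \<open>n\<close> or is cut there into a final and an initial segment.\<close>

lemma cyclic_interval_arc:
  assumes "1 \<le> k" "k \<le> n"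
  shows "cyclic_interval n (arc n a k)"
proof -
  define b where "b = residue n a"
  have n: "n > 0" using assms by simp
  have b: "1 \<le> b" "b \<le> n"
    using n pos_mod_bound[of "int n" a] by (auto simp: b_def residue_def Suc_le_eq nat_less_iff)
  have "int b - 1 = a mod int n" using n by (simp add: b_def residue_def)
  also have "\<dots> = a + int n * (- (a div int n))" by (simp add: minus_mult_div_eq_mod[symmetric])
  finally have eq: "arc n a k = arc n (int b - 1) k" by (simp only: arc_add_period)
  show ?thesis
  proof (cases "b + k \<le> n + 1")
    case True
    then have "arc n a k = {b..<b + k}"
      using eq arc_eq_interval[of b k n] b by simp
    also have "\<dots> = {b..b + k - 1}" using assms by auto
    finally have "arc n a k = {b..b + k - 1}" .
    moreover have "b \<le> b + k - 1" "b + k - 1 \<le> n" using True assms by auto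
    ultimately show ?thesis
      unfolding cyclic_interval_def using b(1) by blast
  next
    case False
    \<comment> \<open>\<open>c\<close> counts the letters beyond \<open>n\<close>;
      \<open>k \<le> n\<close> yields \<open>c \<le> b\<close>, the order that the wrapping form of
      an interval demands.\<close>
    define c where "c = b + k - (n + 1)"
    have k: "k = (n + 1 - b) + c" using False b by (simp add: c_def)
    \<comment> \<open>The cut falls at the integer n, which is 0 up to one period, so the second
      piece starts at the letter 1.\<close>
    have "int b - 1 + int (n + 1 - b) = 0 + int n * 1" using b by simp
    then have "arc n (int b - 1) k = arc n (int b - 1) (n + 1 - b) \<union> arc n (int 1 - 1) c"
      unfolding k arc_split by (simp only: arc_add_period) simp
    also have "\<dots> = {b..<b + (n + 1 - b)} \<union> {1..<1 + c}"
      using b assms False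
      by (subst (1 2) arc_eq_interval) (auto simp: c_def)
    also have "\<dots> = {b..n} \<union> {1..c}" using b by auto
    finally have "arc n a k = {b..n} \<union> {1..c}" using eq by simp
    moreover have "1 \<le> c" "c \<le> b" using False b assms by (auto simp: c_def)
    ultimately show ?thesis
      unfolding cyclic_interval_def using b(2) by blast
  qed
qed

lemma cyclic_interval_imp_arc:
  assumes "cyclic_interval n I"
  shows "\<exists>a. I = arc n a (card I)"
proof -
  obtain a b where ab: "1 \<le> a" "a \<le> b" "b \<le> n" and I: "I = {a..b} \<or> I = {b..n} \<union> {1..a}"
    using assms by (auto simp: cyclic_interval_def)
  show ?thesis
  proof (cases "I = {a..b}")
    case True
    then have "I = arc n (int a - 1) (card I)"
      using ab by (subst arc_eq_interval) auto
    then show ?thesis by blast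
  next
    case False
    then have I: "I = {b..n} \<union> {1..a}" using I by simp
    show ?thesis
    \<comment> \<open>For \<open>a = b\<close> the two segments share a letter and their lengths do
      not add up; the union is then the full set.\<close>
    proof (cases "a = b")
      case True
      then have "I = {1..n}" using I ab by auto
      then have "I = arc n 0 (card I)" using ab arc_full[of n 0] by simp
      then show ?thesis ..
    next
      case False
      then have "card I = (n + 1 - b) + a"
        unfolding I using ab by (subst card_Un_disjoint) auto
      moreover have "int b - 1 + int (n + 1 - b) = 0 + int n * 1" using ab by simp
      ultimately have "arc n (int b - 1) (card I)
          = arc n (int b - 1) (n + 1 - b) \<union> arc n (int 1 - 1) a"
        unfolding arc_split by (simp only: arc_add_period arc_split) simp
      also have "\<dots> = {b..<b + (n + 1 - b)} \<union> {1..<1 + a}"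
        using ab by (subst (1 2) arc_eq_interval) auto
      also have "\<dots> = I" unfolding I using ab by auto
      finally show ?thesis by metis
    qed
  qed
qed

section \<open>Arcs that differ by one or two letters\<close>

text \<open>After a shift of \<open>b\<close> to \<open>c\<close> with c \<le> a \<le> c + j, a gap
  of 2 or more between \<open>c\<close> and \<open>a\<close> would make the shorter arc stick out on
  the right. The bound \<open>j + 1 < n\<close> keeps this from being hidden by wrapping.\<close>

lemma arc_step:
  assumes "1 \<le> j" "j + 1 < n" "arc n a j \<subseteq> arc n b (j + 1)"
  shows "\<exists>t. b + int n * t = a \<or> b + int n * t = a - 1"
proof -
  have n: "n > 0" using assms by simp
  have "residue n a \<in> arc n a j" using assms by (auto simp: arc_def)
  then have "residue n a \<in> arc n b (j + 1)" using assms by blast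
  then obtain k where k: "b \<le> k" "k < b + int (j + 1)" "residue n a = residue n k"
    by (auto simp: arc_def)
  then have "int n dvd a - k" using n by (simp add: residue_eq_iff mod_eq_dvd_iff)
  then obtain t where t: "a - k = int n * t" ..
  define c where "c = b + int n * t"
  have c: "c \<le> a" "a \<le> c + int j" using k t by (auto simp: c_def)
  have sub: "arc n a j \<subseteq> arc n c (j + 1)" using assms by (simp add: c_def arc_add_period)
  have "a \<le> c + 1"
  proof (rule ccontr)
    assume "\<not> a \<le> c + 1"
    \<comment> \<open>This is the first integer to the right of the longer arc; the
      \<open>j + 2 \<le> n\<close> integers from \<open>c\<close> up to it have distinct
      residues.\<close>
    then have "residue n (c + int j + 1) \<in> arc n a j" using c by (auto simp: arc_def)
    then have "residue n (c + int j + 1) \<in> residue n ` {c..<c + int (j + 1)}"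
      using sub by (auto simp: arc_def)
    then obtain x where "x \<in> {c..<c + int (j + 1)}" "residue n (c + int j + 1) = residue n x"
      by auto
    then show False
      using inj_onD[OF residue_inj_on[of "j + 2" n c], of "c + int j + 1" x] assms by auto
  qed
  then show ?thesis using c by (intro exI[of _ t]) (auto simp: c_def)
qed

text \<open>The large arc arises from [a, a + i) by adding a point at either end. The left end after
  the first addition is a or a - 1 according to the order, and \<open>2 * a - 1 - b\<close> is the
  other choice.\<close>

lemma arc_exchange:
  assumes "i + 2 \<le> n" "b = a \<or> b = a - 1"
  shows "arc n (2 * a - 1 - b) (i + 1) = arc n a i \<union> (arc n (a - 1) (i + 2) - arc n b (i + 1))"
proof -
  let ?A = "{a..<a + int i}" and ?B = "{b..<b + int (i + 1)}" and ?C = "{a - 1..<a - 1 + int (i + 2)}"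
  have inj: "inj_on (residue n) ?C" using assms by (intro residue_inj_on)
  have "?B \<subseteq> ?C" using assms by auto
  then have "arc n (a - 1) (i + 2) - arc n b (i + 1) = residue n ` (?C - ?B)"
    unfolding arc_def by (intro inj_on_image_set_diff[OF inj, symmetric]) auto
  moreover have "?A \<union> (?C - ?B) = {2 * a - 1 - b..<2 * a - 1 - b + int (i + 1)}"
    using assms by auto
  ultimately show ?thesis unfolding arc_def by (metis image_Un)
qed

section \<open>Lifting arc permutations to integer paths\<close>

text \<open>Only the values at 1, ..., n - 1 count: the prefix of length \<open>n\<close> is
  everything and has no preferred left end.\<close>

definition descending_path :: "nat \<Rightarrow> (nat \<Rightarrow> int) \<Rightarrow> bool" where
  "descending_path n l \<longleftrightarrow> (\<forall>j. 1 \<le> j \<and> j + 1 < n \<longrightarrow> l (j + 1) = l j \<or> l (j + 1) = l j - 1)"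

definition lifts :: "nat \<Rightarrow> (nat \<Rightarrow> int) \<Rightarrow> (nat \<Rightarrow> nat) \<Rightarrow> bool" where
  "lifts n l \<pi> \<longleftrightarrow> descending_path n l \<and> \<pi> permutes {1..n} \<and>
     (\<forall>j. 1 \<le> j \<and> j < n \<longrightarrow> \<pi> ` {1..j} = arc n (l j) j)"

lemma lifts_imp_arc_permutation:
  assumes "lifts n l \<pi>"
  shows "\<pi> \<in> arc_permutations n"
proof -
  have "cyclic_interval n (\<pi> ` {1..j})" if "1 \<le> j" "j \<le> n" for j
  proof (cases "j = n")
    case True
    then have "\<pi> ` {1..j} = arc n 0 j"
      using assms that arc_full[of n 0] permutes_image[of \<pi> "{1..n}"] by (simp add: lifts_def)
    then show ?thesis using that by (simp add: cyclic_interval_arc)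
  next
    case False
    then show ?thesis using assms that by (simp add: lifts_def cyclic_interval_arc)
  qed
  then show ?thesis using assms by (simp add: arc_permutations_def lifts_def)
qed

text \<open>Successive prefixes differ exactly by the letter \<open>\<pi> j\<close>, and the
  prefixes of length 0 and \<open>n\<close> agree for all permutations.\<close>

lemma permutes_eq_of_prefixes:
  fixes \<pi> \<pi>' :: "nat \<Rightarrow> nat"
  assumes p: "\<pi> permutes {1..n}" "\<pi>' permutes {1..n}"
    and e: "\<And>j. 1 \<le> j \<Longrightarrow> j < n \<Longrightarrow> \<pi> ` {1..j} = \<pi>' ` {1..j}"
  shows "\<pi> = \<pi>'"
proof
  have e': "\<pi> ` {1..j} = \<pi>' ` {1..j}" if "j \<le> n" for j
    using e[of j] that permutes_image[OF p(1)] permutes_image[OF p(2)]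
    by (cases "j = 0"; cases "j = n") auto
  have last: "\<rho> ` {1..j} - \<rho> ` {1..j - 1} = {\<rho> j}" if "\<rho> permutes {1..n}" "1 \<le> j" for \<rho> j
  proof -
    have "{1..j} - {1..j - 1} = {j}" using that by auto
    then show ?thesis
      using inj_on_image_set_diff[of \<rho> UNIV "{1..j}" "{1..j - 1}"] permutes_inj[OF that(1)] by simp
  qed
  fix j
  show "\<pi> j = \<pi>' j"
  proof (cases "j \<in> {1..n}")
    case True
    then have "{\<pi> j} = {\<pi>' j}"
      using last[OF p(1), of j] last[OF p(2), of j] e'[of j] e'[of "j - 1"] by fastforce
    then show ?thesis by simp
  next
    case False
    then show ?thesis using p by (simp add: permutes_not_in)
  qed
qed

lemma lifts_unique:
  assumes "lifts n l \<pi>" "lifts n l' \<pi>'"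
    "\<And>j. 1 \<le> j \<Longrightarrow> j < n \<Longrightarrow> \<exists>t. l' j = l j + int n * t"
  shows "\<pi> = \<pi>'"
proof (rule permutes_eq_of_prefixes)
  show "\<pi> permutes {1..n}" "\<pi>' permutes {1..n}" using assms by (simp_all add: lifts_def)
  show "\<pi> ` {1..j} = \<pi>' ` {1..j}" if "1 \<le> j" "j < n" for j
    using assms that unfolding lifts_def by (metis arc_add_period)
qed

lemma arc_permutation_prefix:
  assumes "\<pi> \<in> arc_permutations n" "1 \<le> j" "j \<le> n"
  obtains a where "\<pi> ` {1..j} = arc n a j"
proof -
  have "inj_on \<pi> {1..j}" using assms permutes_inj_on by (auto simp: arc_permutations_def)
  then have "card (\<pi> ` {1..j}) = j" by (simp add: card_image)
  then show ?thesis
    using that assms cyclic_interval_imp_arc[of n "\<pi> ` {1..j}"] by (auto simp: arc_permutations_def)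
qed

text \<open>The left ends are chosen one prefix at a time: \<open>arc_step\<close> supplies the
  multiple of \<open>n\<close> that brings the next one to the previous value or 1 below it.\<close>

lemma arc_permutation_lifts:
  assumes \<pi>: "\<pi> \<in> arc_permutations n"
  obtains l where "lifts n l \<pi>"
proof -
  \<comment> \<open>The argument \<open>k + 1\<close> constrains precisely the values at 1, ..., k,
    so \<open>k = n - 1\<close> gives the full lift.\<close>
  have "\<exists>l. descending_path (k + 1) l \<and> (\<forall>j. 1 \<le> j \<and> j \<le> k \<longrightarrow> \<pi> ` {1..j} = arc n (l j) j)"
    if "k < n" for k
    using that
  proof (induction k)
    case 0
    then show ?case by (auto simp: descending_path_def)
  next
    case (Suc k)
    then obtain l where l: "descending_path (k + 1) l"
      "\<And>j. 1 \<le> j \<Longrightarrow> j \<le> k \<Longrightarrow> \<pi> ` {1..j} = arc n (l j) j"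
      by auto
    obtain b where b: "\<pi> ` {1..k + 1} = arc n b (k + 1)"
      using arc_permutation_prefix[OF \<pi>, of "k + 1"] Suc.prems by auto
    have "\<exists>t. k = 0 \<or> b + int n * t = l k \<or> b + int n * t = l k - 1"
    proof (cases "k = 0")
      case False
      have "arc n (l k) k \<subseteq> arc n b (k + 1)"
        using l(2)[of k] b False by (metis One_nat_def Suc_leI atLeastatMost_subset_iff image_mono
            le_add1 neq0_conv order_refl)
      then show ?thesis using arc_step[of k n "l k" b] False Suc.prems by auto
    qed simp
    then obtain t where t: "k = 0 \<or> b + int n * t = l k \<or> b + int n * t = l k - 1" ..
    have "descending_path (Suc k + 1) (l(k + 1 := b + int n * t))"
      using l(1) t by (auto simp: descending_path_def less_Suc_eq)
    moreover have "\<pi> ` {1..j} = arc n ((l(k + 1 := b + int n * t)) j) j"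
      if "1 \<le> j" "j \<le> Suc k" for j
      using l(2)[of j] b that by (cases "j = k + 1") (auto simp: arc_add_period)
    ultimately show ?case by blast
  qed
  moreover have "\<pi> permutes {1..n}" using \<pi> by (simp add: arc_permutations_def)
  ultimately have "\<exists>l. lifts n l \<pi>"
  proof (cases n)
    case 0
    then show ?thesis using \<open>\<pi> permutes {1..n}\<close> by (simp add: lifts_def descending_path_def)
  next
    case (Suc k)
    then obtain l where "descending_path n l"
      "\<And>j. 1 \<le> j \<Longrightarrow> j \<le> k \<Longrightarrow> \<pi> ` {1..j} = arc n (l j) j"
      using \<open>\<And>k. k < n \<Longrightarrow> _\<close>[of k] by auto
    then show ?thesis using Suc \<open>\<pi> permutes {1..n}\<close> by (auto simp: lifts_def)
  qed
  then show ?thesis using that by blast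
qed

section \<open>Adjacent exchanges and affine reflections\<close>

text \<open>Only the prefix of length \<open>i + 1\<close> separates the two exchanged positions.
  Its new letter is written as a difference of prefixes to match
  \<open>arc_exchange\<close>.\<close>

lemma image_transpose_prefix:
  fixes \<pi> :: "nat \<Rightarrow> nat"
  assumes "inj \<pi>"
  shows "(\<pi> \<circ> transpose (i + 1) (i + 2)) ` {1..j} =
    (if j = i + 1 then \<pi> ` {1..i} \<union> (\<pi> ` {1..i + 2} - \<pi> ` {1..i + 1}) else \<pi> ` {1..j})"
proof -
  let ?\<tau> = "transpose (i + 1) (i + 2)"
  have "{1..i + 1} = insert (i + 1) {1..i}" by auto
  then have "?\<tau> ` {1..i + 1} = insert (i + 2) {1..i}" by (auto simp: transpose_def image_iff)
  also have "\<dots> = {1..i} \<union> ({1..i + 2} - {1..i + 1})" by auto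
  finally have "(\<pi> \<circ> ?\<tau>) ` {1..i + 1} = \<pi> ` {1..i} \<union> (\<pi> ` {1..i + 2} - \<pi> ` {1..i + 1})"
    using assms by (simp only: image_comp[symmetric] image_Un image_set_diff)
  moreover have "?\<tau> ` {1..j} = {1..j}" if "j \<noteq> i + 1"
  proof (cases "j \<le> i")
    case True
    then have "?\<tau> x = x" if "x \<in> {1..j}" for x using that by (auto simp: transpose_def)
    then show ?thesis by simp
  next
    case False
    then show ?thesis using that by (intro transpose_image_eq) auto
  qed
  ultimately show ?thesis by (auto simp only: image_comp[symmetric] split: if_splits)
qed

text \<open>The neighbouring prefixes are described through \<open>a\<close>, not through
  \<open>l i\<close> and \<open>l (i + 2)\<close>, so that the empty prefix (\<open>i = 0\<close>)
  and the full one (\<open>i + 2 = n\<close>) are covered too.\<close>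

lemma lifts_exchange:
  assumes "lifts n l \<pi>" "i + 2 \<le> n"
    and "\<pi> ` {1..i} = arc n a i" "\<pi> ` {1..i + 2} = arc n (a - 1) (i + 2)"
    and "l (i + 1) = a \<or> l (i + 1) = a - 1"
    and "descending_path n (l(i + 1 := 2 * a - 1 - l (i + 1)))"
  shows "lifts n (l(i + 1 := 2 * a - 1 - l (i + 1))) (\<pi> \<circ> transpose (i + 1) (i + 2))"
proof -
  have p: "\<pi> permutes {1..n}" using assms by (simp add: lifts_def)
  then have p': "\<pi> \<circ> transpose (i + 1) (i + 2) permutes {1..n}"
    using assms by (intro permutes_compose permutes_swap_id) auto
  have "\<pi> ` {1..i + 1} = arc n (l (i + 1)) (i + 1)"
    using assms(1,2) by (simp add: lifts_def)
  moreover have "arc n (2 * a - 1 - l (i + 1)) (i + 1) =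
      arc n a i \<union> (arc n (a - 1) (i + 2) - arc n (l (i + 1)) (i + 1))"
    by (intro arc_exchange assms)
  ultimately have "(\<pi> \<circ> transpose (i + 1) (i + 2)) ` {1..j} =
      arc n ((l(i + 1 := 2 * a - 1 - l (i + 1))) j) j" if "1 \<le> j" "j < n" for j
    using assms(1,3,4) that unfolding lifts_def image_transpose_prefix[OF permutes_inj[OF p]]
    by (cases "j = i + 1") (simp_all only: fun_upd_same fun_upd_other if_True if_False simp_thms)
  then show ?thesis using p' assms(6) by (simp only: lifts_def) blast
qed

text \<open>
  Affine reflections of \<open>\<int>\<^bsup>n-1\<^esup>\<close>: in the step sequence of a path, an inner one exchanges two adjacent
  steps and the two outer ones flip the first and the last step.
\<close>

definition path_reflection :: "nat \<Rightarrow> nat \<Rightarrow> (nat \<Rightarrow> int) \<Rightarrow> (nat \<Rightarrow> int)" where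
  "path_reflection n i l = l(i + 1 :=
     (if i = 0 then 2 * l (i + 2) + 1 else if i + 2 = n then 2 * l i - 1 else l i + l (i + 2)) - l (i + 1))"

text \<open>Here both steps around \<open>i + 1\<close> are equal. Modulo \<open>n\<close>, only the
  left end \<open>l (i + 1)\<close> fits between the neighbouring prefixes, so an exchanged arc
  permutation would have the same prefix as \<pi>, which is absurd.\<close>

lemma arc_rho_eq_self:
  assumes "lifts n l \<pi>" "1 \<le> i" "i + 2 < n" "l (i + 2) \<noteq> l i - 1"
  shows "arc_rho n i \<pi> = \<pi>"
proof -
  let ?\<pi>' = "\<pi> \<circ> transpose (i + 1) (i + 2)"
  have p: "\<pi> permutes {1..n}" using assms(1) by (simp add: lifts_def)
  note inj = permutes_inj[OF p]
  note P = image_transpose_prefix[OF inj]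
  have pre: "\<pi> ` {1..j} = arc n (l j) j" if "1 \<le> j" "j < n" for j
    using assms(1) that by (simp add: lifts_def)
  have step: "l (j + 1) = l j \<or> l (j + 1) = l j - 1" if "1 \<le> j" "j + 1 < n" for j
    using assms(1) that by (simp add: lifts_def descending_path_def)
  have two: "i + 1 + 1 = i + 2" by simp
  have fixed: "l (i + 1) = l i \<and> l (i + 2) = l i \<or> l (i + 1) = l i - 1 \<and> l (i + 2) = l i - 2"
    using step[of i] step[of "i + 1", unfolded two] assms by linarith
  have "?\<pi>' \<notin> arc_permutations n"
  proof
    assume "?\<pi>' \<in> arc_permutations n"
    moreover have "1 \<le> i + 1" "i + 1 \<le> n" using assms by simp_all
    ultimately obtain c where c: "?\<pi>' ` {1..i + 1} = arc n c (i + 1)"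
      by (rule arc_permutation_prefix)
    have "?\<pi>' ` {1..i} \<subseteq> ?\<pi>' ` {1..i + 1}" by (intro image_mono) auto
    then have "arc n (l i) i \<subseteq> arc n c (i + 1)" using P[of i i] pre[of i] c assms(2,3) by simp
    then obtain t where t: "c + int n * t = l i \<or> c + int n * t = l i - 1"
      using arc_step[of i n "l i" c] assms(2,3) by auto
    define c' where "c' = c + int n * t"
    have c': "?\<pi>' ` {1..i + 1} = arc n c' (i + 1)" using c by (simp add: c'_def arc_add_period)
    have "?\<pi>' ` {1..i + 1} \<subseteq> ?\<pi>' ` {1..i + 2}" by (intro image_mono) auto
    then have "arc n c' (i + 1) \<subseteq> arc n (l (i + 2)) (i + 1 + 1)"
      using P[of i "i + 2"] pre[of "i + 2"] c' assms(3) by simp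
    then obtain s where s: "l (i + 2) + int n * s = c' \<or> l (i + 2) + int n * s = c' - 1"
      using arc_step[of "i + 1" n c' "l (i + 2)"] assms(3) by auto
    show False
    proof (cases "c' = l (i + 1)")
      case True
      then have "?\<pi>' ` {1..i + 1} = \<pi> ` {1..i + 1}" using pre[of "i + 1"] c' assms(3) by simp
      \<comment> \<open>The exchange moves this letter into position \<open>i + 1\<close>, but it
        lies outside the old prefix of that length.\<close>
      moreover have "\<pi> (i + 2) \<in> ?\<pi>' ` {1..i + 1}"
        by (rule image_eqI[of _ _ "i + 1"]) auto
      ultimately have "\<pi> (i + 2) \<in> \<pi> ` {1..i + 1}" by simp
      then show False using inj by (simp add: inj_image_mem_iff)
    next
      case False
      \<comment> \<open>Any other left end forces a nonzero multiple of \<open>n\<close> of absolute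
        value at most 2, while the bounds on \<open>i\<close> give n \<ge> 4.\<close>
      then have "int n * s \<in> {- 1, - 2, 1, 2}" using s t fixed unfolding c'_def by force
      then have "int n * s \<noteq> 0" "\<bar>int n * s\<bar> \<le> 2" using assms(3) by auto
      moreover have "\<bar>int n\<bar> \<le> \<bar>int n * s\<bar>"
        using \<open>int n * s \<noteq> 0\<close> by (intro dvd_imp_le_int) auto
      ultimately show False using assms(2,3) by simp
    qed
  qed
  then show ?thesis unfolding arc_rho_def by (simp only: if_False)
qed

text \<open>Either the exchange swaps the two possible left ends at \<open>i + 1\<close>, which is
  the reflection, or two equal inner steps make both maps trivial.\<close>

lemma lifts_path_reflection:
  assumes "3 \<le> n" "i \<le> n - 2" "lifts n l \<pi>"
  shows "lifts n (path_reflection n i l) (arc_rho n i \<pi>)"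
proof -
  have p: "\<pi> permutes {1..n}" and d: "descending_path n l" using assms(3) by (simp_all add: lifts_def)
  have pre: "\<pi> ` {1..j} = arc n (l j) j" if "1 \<le> j" "j < n" for j
    using assms(3) that by (simp add: lifts_def)
  have step: "l (j + 1) = l j \<or> l (j + 1) = l j - 1" if "1 \<le> j" "j + 1 < n" for j
    using d that by (simp add: descending_path_def)
  \<comment> \<open>All cases where the path moves share this argument; \<open>a\<close> is the left
    end of the prefix of length \<open>i\<close>, and \<open>a - 1\<close> that of length
    \<open>i + 2\<close>.\<close>
  have exchange: "lifts n (path_reflection n i l) (arc_rho n i \<pi>)"
    if a: "\<pi> ` {1..i} = arc n a i" "\<pi> ` {1..i + 2} = arc n (a - 1) (i + 2)"
      "l (i + 1) = a \<or> l (i + 1) = a - 1"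
      and eq: "path_reflection n i l = l(i + 1 := 2 * a - 1 - l (i + 1))"
      and before: "1 \<le> i \<Longrightarrow> l i = a"
      and after: "i + 2 < n \<Longrightarrow> l (i + 2) = a - 1"
    for a
  proof -
    have "(l(i + 1 := 2 * a - 1 - l (i + 1))) (j + 1) = (l(i + 1 := 2 * a - 1 - l (i + 1))) j
       \<or> (l(i + 1 := 2 * a - 1 - l (i + 1))) (j + 1) = (l(i + 1 := 2 * a - 1 - l (i + 1))) j - 1"
      if "1 \<le> j" "j + 1 < n" for j
    proof -
      consider "j = i" | "j = i + 1" | "j \<noteq> i" "j \<noteq> i + 1" by blast
      then show ?thesis
      proof cases
        case 1
        then have "1 \<le> i" using that by simp
        then show ?thesis using before a(3) unfolding 1 by (simp; linarith)
      next
        case 2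
        then have "i + 2 < n" using that by simp
        then have "l (i + 1 + 1) = a - 1" using after by (simp add: numeral_2_eq_2)
        then show ?thesis using a(3) unfolding 2 by (simp; linarith)
      next
        case 3
        then show ?thesis using step[OF that] by simp
      qed
    qed
    then have "lifts n (path_reflection n i l) (\<pi> \<circ> transpose (i + 1) (i + 2))"
      unfolding eq using assms a by (intro lifts_exchange) (simp_all add: descending_path_def)
    moreover from this have "\<pi> \<circ> transpose (i + 1) (i + 2) \<in> arc_permutations n"
      by (rule lifts_imp_arc_permutation)
    ultimately show ?thesis unfolding arc_rho_def by (simp only: if_True)
  qed
  consider "i = 0" | "1 \<le> i" "i + 2 = n" | "1 \<le> i" "i + 2 < n" "l (i + 2) = l i - 1"
    | "1 \<le> i" "i + 2 < n" "l (i + 2) = l i" "l (i + 1) = l i"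
    | "1 \<le> i" "i + 2 < n" "l (i + 2) = l i - 2" "l (i + 1) = l i - 1"
  proof -
    have two: "i + 1 + 1 = i + 2" by simp
    have "i = 0 \<or> 1 \<le> i \<and> i + 2 = n \<or> 1 \<le> i \<and> i + 2 < n" using assms by linarith
    then show ?thesis
    proof (elim disjE conjE)
      assume i: "1 \<le> i" "i + 2 < n"
      then have "l (i + 1) = l i \<or> l (i + 1) = l i - 1" using step[of i] by linarith
      moreover have "l (i + 2) = l (i + 1) \<or> l (i + 2) = l (i + 1) - 1"
        using i step[of "i + 1", unfolded two] by linarith
      ultimately show ?thesis using that(3-5) i by (smt (verit))
    next
      assume "i = 0"
      then show ?thesis by (rule that(1))
    next
      assume "1 \<le> i" "i + 2 = n"
      then show ?thesis by (rule that(2))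
    qed
  qed
  then show ?thesis
  proof cases
    case 1
    have two: "1 + 1 = (2 :: nat)" by simp
    have "l 1 = l 2 + 1 \<or> l 1 = l 2" using step[of 1, unfolded two] assms(1) by fastforce
    moreover have "\<pi> ` {1..2} = arc n (l 2) 2" using pre[of 2] assms(1) by simp
    ultimately show ?thesis
      \<comment> \<open>The empty prefix is an arc with any left end, so \<open>a\<close> is
        dictated by the prefix of length 2.\<close>
      using 1 by (intro exchange[of "l 2 + 1"]) (simp_all add: path_reflection_def arc_def numeral_2_eq_2 algebra_simps)
  next
    case 2
    \<comment> \<open>The full set is an arc with any left end, in particular the one that
      \<open>exchange\<close> wants.\<close>
    have "\<pi> ` {1..i + 2} = arc n (l i - 1) (i + 2)"
      unfolding \<open>i + 2 = n\<close> using assms(1) permutes_image[OF p] by (simp add: arc_full)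
    then show ?thesis
      using 2 pre[of i] step[of i] by (intro exchange[of "l i"]) (simp_all add: path_reflection_def)
  next
    case 3
    have "l (i + 1) = l i \<or> l (i + 1) = l i - 1" using 3 step[of i] by simp
    moreover have "\<pi> ` {1..i + 2} = arc n (l i - 1) (i + 2)" using 3 pre[of "i + 2"] by simp
    moreover have "\<pi> ` {1..i} = arc n (l i) i" using 3 pre[of i] by simp
    ultimately show ?thesis
      using 3 by (intro exchange[of "l i"]) (simp_all add: path_reflection_def)
  next
    case 4
    \<comment> \<open>With equal steps \<open>l (i + 1)\<close> is the midpoint of its
      neighbours.\<close>
    then have "path_reflection n i l = l" by (auto simp: path_reflection_def fun_eq_iff)
    then show ?thesis using arc_rho_eq_self[of n l \<pi> i] assms 4 by simp
  next
    case 5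
    then have "path_reflection n i l = l" by (auto simp: path_reflection_def fun_eq_iff)
    then show ?thesis using arc_rho_eq_self[of n l \<pi> i] assms 5 by simp
  qed
qed

section \<open>The action of the affine Weyl group\<close>

text \<open>Von Dyck's principle for actions. \<open>foldr\<close> lets the last letter act first,
  so concatenation of words becomes composition of maps.\<close>

lemma presented_group_action:
  fixes f :: "'a \<times> bool \<Rightarrow> 'b \<Rightarrow> 'b"
  assumes closed: "\<And>p e. fst p \<in> S \<Longrightarrow> e \<in> E \<Longrightarrow> f p e \<in> E"
    and cancel: "\<And>x b e. x \<in> S \<Longrightarrow> e \<in> E \<Longrightarrow> f (x, b) (f (x, \<not> b) e) = e"
    and rel: "\<And>r e. r \<in> R \<Longrightarrow> r \<in> words S \<Longrightarrow> e \<in> E \<Longrightarrow> foldr f r e = e"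
  obtains \<phi> where "group_action (presented_group S R) E \<phi>"
    and "\<And>w e. w \<in> words S \<Longrightarrow> e \<in> E \<Longrightarrow> \<phi> (pres_class S R w) e = foldr f w e"
proof -
  have foldr_closed: "foldr f w e \<in> E" if "w \<in> words S" "e \<in> E" for w e
    using that(1) by (induction w) (auto simp: closed that(2))
  have foldr_eq: "foldr f v e = foldr f w e" if "pres_eq S R v w" "e \<in> E" for v w e
    using that(1) by (induction rule: pres_eq.induct) (simp_all add: foldr_closed cancel rel that(2))
  \<comment> \<open>The restriction makes the maps extensional, as \<open>Bij E\<close>
    requires.\<close>
  define act where "act w = restrict (foldr f w) E" for w
  define \<phi> where "\<phi> X = act (SOME w. w \<in> words S \<and> X = pres_class S R w)" for X
  have \<phi>: "\<phi> (pres_class S R w) = act w" if w: "w \<in> words S" for w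
  proof -
    define v where "v = (SOME v. v \<in> words S \<and> pres_class S R w = pres_class S R v)"
    have "v \<in> words S \<and> pres_class S R w = pres_class S R v"
      unfolding v_def by (rule someI[of _ w]) (simp add: w)
    then have "pres_eq S R w v" using pres_class_eq_iff[OF w] by blast
    then have "act w = act v" unfolding act_def by (intro restrict_ext foldr_eq)
    then show ?thesis by (simp add: \<phi>_def v_def)
  qed
  have inv: "foldr f (word_inv w) (foldr f w e) = e" if "w \<in> words S" "e \<in> E" for w e
    using foldr_eq[OF word_inv_cancel[OF that(1)] that(2)] by simp
  have inv_inv: "word_inv (word_inv w) = w" for w :: "'a word"
    by (induction w) (auto simp: word_inv_def)
  have bij: "act w \<in> Bij E" if w: "w \<in> words S" for w
  proof -
    have "bij_betw (foldr f w) E E"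
      using foldr_closed[OF w] foldr_closed[OF word_inv_words[OF w]] inv[OF w]
        inv[OF word_inv_words[OF w], unfolded inv_inv]
      by (intro bij_betwI[of _ _ _ "foldr f (word_inv w)"]) auto
    then have "bij_betw (act w) E E" unfolding act_def by (simp cong: bij_betw_cong)
    then show ?thesis by (simp add: Bij_def act_def)
  qed
  have mult: "act (v @ w) = compose E (act v) (act w)" if "v \<in> words S" "w \<in> words S" for v w
    using that foldr_closed by (auto simp: act_def compose_def)
  have "\<phi> \<in> hom (presented_group S R) (BijGroup E)"
    by (rule homI)
      (auto simp: presented_group_def[of S R, THEN arg_cong[of _ _ carrier]] presented_group_mult
        \<phi> bij mult BijGroup_def)
  then have "group_action (presented_group S R) E \<phi>"
    by (simp add: group_action_def group_hom_def group_hom_axioms_def group_presented_group group_BijGroup)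
  then show ?thesis by (rule that) (simp add: \<phi> act_def)
qed

section \<open>Coxeter relations and the action\<close>

text \<open>The path \<open>l\<close> is arbitrary: the reflections are affine maps of the whole
  space, so each relator is a coordinatewise linear identity.\<close>

lemma path_reflection_relator:
  assumes "4 \<le> n" "r \<in> affine_C_relators (n - 2)"
  shows "foldr (\<lambda>p. path_reflection n (fst p)) r l = l"
proof -
  consider (square) i where "r = word_pow [(i, True)] 2"
    | (commute) i j where "\<bar>int j - int i\<bar> > 1" "r = word_pow [(i, True), (j, True)] 2"
    | (braid) i where "1 \<le> i" "i + 3 < n" "r = word_pow [(i, True), (i + 1, True)] 3"
    | (first) "r = word_pow [(0, True), (1, True)] 4"
    | (last) "r = word_pow [(n - 3, True), (n - 2, True)] 4"
  proof -
    have "n - 2 - 1 + 1 = n - 2" "n - 2 - 1 = n - 3" using assms(1) by simp_all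
    then show ?thesis
      using assms that unfolding affine_C_relators_def by (auto 0 3)
  qed
  then show ?thesis
  proof cases
    case square
    then show ?thesis by (auto simp: path_reflection_def word_pow_def numeral_2_eq_2)
  next
    case commute
    \<comment> \<open>Neither reflection reads the coordinate that the other one changes.\<close>
    then have "i \<noteq> j" "i \<noteq> j + 1" "j \<noteq> i + 1" by auto
    then show ?thesis
      using commute by (auto simp: path_reflection_def word_pow_def numeral_2_eq_2 fun_eq_iff)
  next
    case braid
    then show ?thesis
      by (auto simp: path_reflection_def word_pow_def numeral_3_eq_3 fun_eq_iff)
  next
    case first
    then show ?thesis using assms(1)
      by (auto simp: path_reflection_def word_pow_def eval_nat_numeral fun_eq_iff)
  next
    case last
    \<comment> \<open>Writing \<open>n\<close> this way removes the truncated subtractions in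
      \<open>n - 3\<close> and \<open>n - 2\<close>.\<close>
    obtain k where "n = k + 4" using assms(1) le_Suc_ex[of 4 n] by (auto simp: add.commute)
    then show ?thesis using last
      by (auto simp: path_reflection_def word_pow_def eval_nat_numeral fun_eq_iff)
  qed
qed

lemma lifts_foldr:
  assumes "3 \<le> n" "lifts n l \<pi>" "w \<in> words {0..n - 2}"
  shows "lifts n (foldr (\<lambda>p. path_reflection n (fst p)) w l) (foldr (\<lambda>p. arc_rho n (fst p)) w \<pi>)"
  using assms(3) by (induction w) (simp_all add: assms(1,2) lifts_path_reflection)

lemma arc_action_exists:
  assumes n: "4 \<le> n"
  shows "\<exists>\<phi>. arc_action n \<phi>"
proof -
  let ?S = "{0..n - 2}" and ?R = "affine_C_relators (n - 2)"
  \<comment> \<open>The sign of a letter is ignored because each \<open>arc_rho n i\<close> turns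
    out to be its own inverse on arc permutations.\<close>
  let ?f = "\<lambda>p :: nat \<times> bool. arc_rho n (fst p)"
  \<comment> \<open>If a word fixes all paths, then the image of \<pi> under it has the same lift as
    \<pi> and equals \<pi>.\<close>
  have trivial: "foldr ?f w \<pi> = \<pi>"
    if w: "w \<in> words ?S" "\<And>l. foldr (\<lambda>p. path_reflection n (fst p)) w l = l"
      and \<pi>: "\<pi> \<in> arc_permutations n" for w \<pi>
  proof -
    obtain l where l: "lifts n l \<pi>" using \<pi> by (rule arc_permutation_lifts)
    have "lifts n l (foldr ?f w \<pi>)" using lifts_foldr[OF _ l w(1)] n w(2) by simp
    then show ?thesis using l by (rule lifts_unique) (rule exI[of _ 0], simp)
  qed
  show ?thesis
  proof (rule presented_group_action[of ?S "arc_permutations n" ?f ?R])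
    show "?f p \<pi> \<in> arc_permutations n" if "\<pi> \<in> arc_permutations n" for p \<pi>
      using that by (simp add: arc_rho_def)
    show "?f (i, b) (?f (i, \<not> b) \<pi>) = \<pi>"
      if "i \<in> ?S" "\<pi> \<in> arc_permutations n" for i b \<pi>
      using trivial[of "[(i, b), (i, \<not> b)]" \<pi>] that by (simp add: path_reflection_def)
    show "foldr ?f r \<pi> = \<pi>"
      if "r \<in> ?R" "r \<in> words ?S" "\<pi> \<in> arc_permutations n" for r \<pi>
      using that(2) path_reflection_relator[OF n that(1)] that(3) by (rule trivial)
  next
    fix \<phi>
    assume "group_action (presented_group ?S ?R) (arc_permutations n) \<phi>"
      and \<phi>: "\<And>w \<pi>. w \<in> words ?S \<Longrightarrow> \<pi> \<in> arc_permutations n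
        \<Longrightarrow> \<phi> (pres_class ?S ?R w) \<pi> = foldr ?f w \<pi>"
    moreover have "\<phi> (pres_class ?S ?R [(i, True)]) \<pi> = arc_rho n i \<pi>"
      if "i \<le> n - 2" "\<pi> \<in> arc_permutations n" for i \<pi>
      using \<phi>[of "[(i, True)]" \<pi>] that by simp
    ultimately have "arc_action n \<phi>"
      by (simp add: arc_action_def affine_C_def affine_C_gen_def)
    then show ?thesis by blast
  qed
qed

section \<open>Transitivity\<close>

text \<open>On a nonconstant path the first drop is moved one place earlier, lowering the value just
  before it. On a constant path the last reflection creates a drop at the end.\<close>

lemma lowering_reflection:
  assumes "3 \<le> n" "descending_path n l" "1 \<le> k" "k < n" "c < l k"
    and c: "\<And>j. 1 \<le> j \<Longrightarrow> j < n \<Longrightarrow> c \<le> l j"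
  obtains i where "i \<le> n - 2" "path_reflection n i l = l(i + 1 := l (i + 1) - 1)" "c < l (i + 1)"
proof (cases "\<exists>j. 1 \<le> j \<and> j < n \<and> l j \<noteq> l 1")
  case True
  define j where "j = (LEAST j. 1 \<le> j \<and> j < n \<and> l j \<noteq> l 1)"
  have j: "1 \<le> j" "j < n" "l j \<noteq> l 1" using LeastI_ex[OF True] by (simp_all add: j_def)
  have before: "l i = l 1" if "1 \<le> i" "i < j" for i
    using not_less_Least[of i "\<lambda>j. 1 \<le> j \<and> j < n \<and> l j \<noteq> l 1"] that j(2) unfolding j_def
    by (metis less_trans)
  have "j \<noteq> 1" using j(3) by auto
  then have "j = j - 2 + 2" using j(1) by simp
  then obtain i where i: "j = i + 2" ..
  have l1: "l (i + 1) = l 1" using before[of "i + 1"] i by simp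
  have "l (i + 1 + 1) = l (i + 1) \<or> l (i + 1 + 1) = l (i + 1) - 1"
    using assms(2) i j(2) unfolding descending_path_def by simp
  moreover have "i + 1 + 1 = i + 2" by simp
  ultimately have l2: "l (i + 2) = l (i + 1) - 1" using i j(3) l1 by metis
  have "l i = l (i + 1)" if "i \<noteq> 0" using before[of i] that i l1 by simp
  then have "path_reflection n i l = l(i + 1 := l (i + 1) - 1)"
    using l2 i j(2) by (cases "i = 0") (simp_all add: path_reflection_def fun_eq_iff numeral_2_eq_2)
  \<comment> \<open>The value after the drop is still at least \<open>c\<close>, so the one before
    it exceeds \<open>c\<close>.\<close>
  moreover have "c < l (i + 1)" using c[of "i + 2"] i j(2) l2 by simp
  ultimately show ?thesis using i j(2) by (intro that[of i]) simp_all
next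
  case False
  then have const: "l j = l 1" if "1 \<le> j" "j < n" for j using that by blast
  have n: "n - 2 + 1 = n - 1" "n - 2 + 2 = n" "n - 2 \<noteq> 0" using assms(1) by simp_all
  have l: "l (n - 1) = l 1" "l (n - 2) = l 1"
    using const[of "n - 1"] const[of "n - 2"] assms(1) by simp_all
  have "l k = l 1" using assms(3,4) by (rule const)
  then have "c < l (n - 2 + 1)" using assms(5) l(1) unfolding n(1) by simp
  moreover have "path_reflection n (n - 2) l = l(n - 2 + 1 := l (n - 2 + 1) - 1)"
    unfolding path_reflection_def n using n(3) l by simp
  ultimately show ?thesis by (intro that[of "n - 2"]) simp_all
qed

text \<open>Induction on the total height of the path above \<open>c\<close>, which every lowering
  reflection reduces.\<close>

lemma lifts_constant_reachable:
  assumes n: "3 \<le> n"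
    and "lifts n l \<pi>" "\<And>j. 1 \<le> j \<Longrightarrow> j < n \<Longrightarrow> c \<le> l j"
  shows "\<exists>is. set is \<subseteq> {0..n - 2} \<and> lifts n (\<lambda>_. c) (foldr (arc_rho n) is \<pi>)"
  using assms(2,3)
proof (induction "nat (\<Sum>j\<in>{1..<n}. l j - c)" arbitrary: l \<pi> rule: less_induct)
  case less
  note c = less.prems(2)
  show ?case
  proof (cases "\<exists>k. 1 \<le> k \<and> k < n \<and> c < l k")
    case True
    then obtain k where k: "1 \<le> k" "k < n" "c < l k" by blast
    have "descending_path n l" using less.prems(1) by (simp add: lifts_def)
    with n obtain i where i: "i \<le> n - 2" "path_reflection n i l = l(i + 1 := l (i + 1) - 1)" "c < l (i + 1)"
      using k c by (rule lowering_reflection)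
    let ?l = "l(i + 1 := l (i + 1) - 1)"
    have lift: "lifts n ?l (arc_rho n i \<pi>)"
      using lifts_path_reflection[OF n i(1) less.prems(1)] i(2) by simp
    have bound: "c \<le> ?l j" if "1 \<le> j" "j < n" for j using c[OF that] i(3) by auto
    have mem: "i + 1 \<in> {1..<n}" using i(1) n by auto
    have "(\<Sum>j\<in>{1..<n}. ?l j - c) < (\<Sum>j\<in>{1..<n}. l j - c)"
      using mem by (intro sum_strict_mono_ex1) auto
    moreover have "0 \<le> (\<Sum>j\<in>{1..<n}. ?l j - c)"
      using bound by (intro sum_nonneg) (simp del: fun_upd_apply)
    ultimately have "nat (\<Sum>j\<in>{1..<n}. ?l j - c) < nat (\<Sum>j\<in>{1..<n}. l j - c)" by simp
    then obtain js where "set js \<subseteq> {0..n - 2}"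
      "lifts n (\<lambda>_. c) (foldr (arc_rho n) js (arc_rho n i \<pi>))"
      using less.hyps[OF _ lift bound] by blast
    \<comment> \<open>\<open>foldr\<close> applies the last entry first, so the reflection just used
      goes to the end of the list.\<close>
    then show ?thesis using i(1) by (intro exI[of _ "js @ [i]"]) simp
  next
    case False
    then have "l j = c" if "1 \<le> j" "j < n" for j using c[OF that] that by force
    then have "lifts n (\<lambda>_. c) \<pi>" using less.prems(1) by (simp add: lifts_def descending_path_def)
    then show ?thesis by (intro exI[of _ "[]"]) simp
  qed
qed

lemma arc_action_foldr:
  assumes "arc_action n \<phi>" "\<pi> \<in> arc_permutations n" "set is \<subseteq> {0..n - 2}"
  shows "\<exists>g\<in>carrier (affine_C (n - 2)). \<phi> g \<pi> = foldr (arc_rho n) is \<pi>"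
proof -
  interpret group_action "affine_C (n - 2)" "arc_permutations n" \<phi>
    using assms(1) by (simp add: arc_action_def)
  interpret group "affine_C (n - 2)" by (simp add: affine_C_def group_presented_group)
  show ?thesis
    using assms(3)
  proof (induction "is")
    case Nil
    have "\<phi> \<one>\<^bsub>affine_C (n - 2)\<^esub> \<pi> = \<pi>" using assms(2) by (simp add: id_eq_one[symmetric])
    then show ?case by auto
  next
    case (Cons i "is")
    then obtain g where g: "g \<in> carrier (affine_C (n - 2))" "\<phi> g \<pi> = foldr (arc_rho n) is \<pi>"
      by auto
    have s: "affine_C_gen (n - 2) i \<in> carrier (affine_C (n - 2))"
      using Cons.prems by (simp add: affine_C_gen_def affine_C_def presented_group_def)
    have "\<phi> (affine_C_gen (n - 2) i) (\<phi> g \<pi>) = arc_rho n i (\<phi> g \<pi>)"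
      using assms(1) element_image[OF g(1) assms(2) HOL.refl] Cons.prems by (simp add: arc_action_def)
    then have "\<phi> (affine_C_gen (n - 2) i \<otimes>\<^bsub>affine_C (n - 2)\<^esub> g) \<pi> = foldr (arc_rho n) (i # is) \<pi>"
      using composition_rule[OF assms(2) s g(1)] g(2) by simp
    then show ?case using s g(1) by (metis m_closed)
  qed
qed

theorem corollary10p4:
  fixes n :: nat
  assumes "n \<ge> 4"
  shows "(\<exists>\<phi>. arc_action n \<phi>) \<and>
    (\<forall>\<phi>. arc_action n \<phi> \<longrightarrow> transitive_action (affine_C (n - 2)) (arc_permutations n) \<phi>)"
proof (intro conjI allI impI)
  show "\<exists>\<phi>. arc_action n \<phi>" using assms by (rule arc_action_exists)
next
  fix \<phi>
  assume \<phi>: "arc_action n \<phi>"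
  let ?G = "affine_C (n - 2)" and ?A = "arc_permutations n"
  interpret group_action ?G ?A \<phi> using \<phi> by (simp add: arc_action_def)
  interpret group ?G by (simp add: affine_C_def group_presented_group)
  show "transitive_action ?G ?A \<phi>"
  proof
    fix \<pi> \<pi>'
    assume \<pi>: "\<pi> \<in> ?A" and \<pi>': "\<pi>' \<in> ?A"
    obtain l l' where l: "lifts n l \<pi>" "lifts n l' \<pi>'"
      using arc_permutation_lifts[OF \<pi>] arc_permutation_lifts[OF \<pi>'] by metis
    \<comment> \<open>The minimum over both paths is a common lower bound, so both can be lowered to
      the same constant path.\<close>
    define c where "c = Min (l ` {1..<n} \<union> l' ` {1..<n})"
    have c: "c \<le> l j" "c \<le> l' j" if "1 \<le> j" "j < n" for j
      using that unfolding c_def by (auto intro!: Min_le)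
    have "3 \<le> n" using assms by simp
    obtain js js' where js: "set js \<subseteq> {0..n - 2}" "set js' \<subseteq> {0..n - 2}"
      and e: "lifts n (\<lambda>_. c) (foldr (arc_rho n) js \<pi>)" "lifts n (\<lambda>_. c) (foldr (arc_rho n) js' \<pi>')"
      using lifts_constant_reachable[OF \<open>3 \<le> n\<close> l(1) c(1)]
        lifts_constant_reachable[OF \<open>3 \<le> n\<close> l(2) c(2)] by blast
    have eq: "foldr (arc_rho n) js \<pi> = foldr (arc_rho n) js' \<pi>'"
      by (rule lifts_unique[OF e]) (rule exI[of _ 0], simp)
    obtain g h where g: "g \<in> carrier ?G" "\<phi> g \<pi> = foldr (arc_rho n) js \<pi>"
      and h: "h \<in> carrier ?G" "\<phi> h \<pi>' = foldr (arc_rho n) js' \<pi>'"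
      using arc_action_foldr[OF \<phi> \<pi> js(1)] arc_action_foldr[OF \<phi> \<pi>' js(2)] by metis
    \<comment> \<open>Both permutations are carried to the one lifted by the constant path; going
      there by \<open>g\<close> and back by the inverse of \<open>h\<close> links them.\<close>
    have "\<phi> (inv\<^bsub>?G\<^esub> h) (\<phi> g \<pi>) = \<pi>'"
      using orbit_sym_aux[OF h(1) \<pi>' HOL.refl] g(2) h(2) eq by simp
    then have "\<phi> (inv\<^bsub>?G\<^esub> h \<otimes>\<^bsub>?G\<^esub> g) \<pi> = \<pi>'"
      using composition_rule[OF \<pi> _ g(1)] h(1) by simp
    then show "\<exists>g\<in>carrier ?G. \<phi> g \<pi> = \<pi>'" using g(1) h(1) by blast
  qed
qed

end
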